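(* Let $\alpha\in\mathbb{R}$. Then: (a) If $\alpha>1$, the limit (in the norm of $D_\alpha$) of a convergent sequence of non-cyclic functions for $D_\alpha$ is not cyclic for $D_\alpha$. (b) If $\alpha\le 1$, there exists a sequence of non-cyclic functions for $D_\alpha$ that converges in the norm of $D_\alpha$ to a cyclic function for $D_\alpha$.
   Context: $\mathbb{D}$ is the open unit disc in $\mathbb{C}$. For $\alpha\in\mathbb{R}$, the Dirichlet-type space $D_\alpha$ is the Hilbert space of all analytic functions $f(z)=\sum_{k=0}^\infty a_kz^k$ on $\mathbb{D}$ with $\|f\|_\alpha^2:=\sum_{k=0}^\infty |a_k|^2(k+1)^\alpha<\infty$. A function $f\in D_\alpha$ is cyclic (for $D_\alpha$) if the closed linear span in $D_\alpha$ of $\{z^kf: k=0,1,2,\dots\}$ is all of $D_\alpha$, and non-cyclic otherwise. *)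

theory Defs
  imports "HOL-Complex_Analysis.Complex_Analysis" "HOL-Library.Function_Algebras"
begin

text \<open>
  Functions on the unit disc are represented by total functions on the complex plane whose values
  off the disc are irrelevant: membership in the space, the norm, and hence
  cyclicity depend only on the Taylor coefficients at 0. Addition and subtraction of functions are
  pointwise.
\<close>

definition taylor_coeff :: "(complex \<Rightarrow> complex) \<Rightarrow> nat \<Rightarrow> complex" where
  "taylor_coeff f k = fps_nth (fps_expansion f 0) k"

definition dirichlet_space :: "real \<Rightarrow> (complex \<Rightarrow> complex) set" where
  "dirichlet_space \<alpha> =
     {f. f analytic_on ball 0 1 \<and>
         summable (\<lambda>k. (cmod (taylor_coeff f k))\<^sup>2 * (real k + 1) powr \<alpha>)}"

text \<open>Outside \<^const>\<open>dirichlet_space\<close> the value of the following is meaningless.\<close>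

definition dirichlet_norm :: "real \<Rightarrow> (complex \<Rightarrow> complex) \<Rightarrow> real" where
  "dirichlet_norm \<alpha> f =
     sqrt (\<Sum>k. (cmod (taylor_coeff f k))\<^sup>2 * (real k + 1) powr \<alpha>)"

text \<open>The generic \<^const>\<open>span\<close> of the library is over the reals; the spans here are over the
  complex numbers.\<close>

interpretation complex_fun:
  vector_space "\<lambda>(c::complex) (f :: complex \<Rightarrow> complex) z. c * f z"
  by unfold_locales (auto simp: fun_eq_iff algebra_simps)

definition dirichlet_closed_span ::
    "real \<Rightarrow> (complex \<Rightarrow> complex) set \<Rightarrow> (complex \<Rightarrow> complex) set" where
  "dirichlet_closed_span \<alpha> S =
     {g \<in> dirichlet_space \<alpha>.
        \<forall>\<epsilon>>0. \<exists>h \<in> complex_fun.span S. dirichlet_norm \<alpha> (g - h) < \<epsilon>}"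

definition cyclic_fun :: "real \<Rightarrow> (complex \<Rightarrow> complex) \<Rightarrow> bool" where
  "cyclic_fun \<alpha> f \<longleftrightarrow>
     f \<in> dirichlet_space \<alpha> \<and>
     dirichlet_closed_span \<alpha> (range (\<lambda>(k::nat) z. z ^ k * f z)) = dirichlet_space \<alpha>"

definition noncyclic_fun :: "real \<Rightarrow> (complex \<Rightarrow> complex) \<Rightarrow> bool" where
  "noncyclic_fun \<alpha> f \<longleftrightarrow> f \<in> dirichlet_space \<alpha> \<and> \<not> cyclic_fun \<alpha> f"

definition dirichlet_converges ::
    "real \<Rightarrow> (nat \<Rightarrow> complex \<Rightarrow> complex) \<Rightarrow> (complex \<Rightarrow> complex) \<Rightarrow> bool" where
  "dirichlet_converges \<alpha> F g \<longleftrightarrow>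
     (\<forall>n. F n \<in> dirichlet_space \<alpha>) \<and> g \<in> dirichlet_space \<alpha> \<and>
     (\<lambda>n. dirichlet_norm \<alpha> (F n - g)) \<longlonglongrightarrow> 0"

end

theory Submission
  imports Defs "HOL-Real_Asymp.Real_Asymp"
begin

text \<open>A function \<open>f\<close> is cyclic iff some polynomials \<open>p\<close> make \<open>\<parallel>1 - pf\<parallel>\<close> arbitrarily small. For
  \<open>\<alpha> > 1\<close> the space is an algebra under multiplication, so it suffices that \<open>\<parallel>1 - pf\<parallel>\<close> falls below
  a fixed threshold for one \<open>p\<close>, and this is an open condition on \<open>f\<close>. For \<open>\<alpha> \<le> 1\<close> the function
  \<open>1 - z\<close> is cyclic, but it is the limit of \<open>1 - (1 + 1/n)z\<close>, whose zero in the disc obstructs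
  cyclicity because point evaluations are continuous.\<close>

section \<open>The space on the level of Taylor coefficients\<close>

definition dirichlet_fps :: "real \<Rightarrow> complex fps set" where
  "dirichlet_fps \<alpha> = {A. summable (\<lambda>k. (cmod (fps_nth A k))\<^sup>2 * (real k + 1) powr \<alpha>)}"

text \<open>The square of the norm: estimates then need no square roots. The value is meaningful
  only on \<open>dirichlet_fps\<close>, which is why membership is carried along with every
  bound.\<close>

definition sq_norm :: "real \<Rightarrow> complex fps \<Rightarrow> real" where
  "sq_norm \<alpha> A = (\<Sum>k. (cmod (fps_nth A k))\<^sup>2 * (real k + 1) powr \<alpha>)"

lemma sq_norm_nonneg: "A \<in> dirichlet_fps \<alpha> \<Longrightarrow> 0 \<le> sq_norm \<alpha> A"
  unfolding dirichlet_fps_def sq_norm_def by (auto intro: suminf_nonneg)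

lemma cmod_diff_squared_le: "(cmod (a - b))\<^sup>2 \<le> 2 * (cmod a)\<^sup>2 + 2 * (cmod b)\<^sup>2"
proof -
  have "(cmod (a - b))\<^sup>2 \<le> (cmod a + cmod b)\<^sup>2"
    by (intro power_mono norm_triangle_ineq4) auto
  also have "\<dots> \<le> 2 * (cmod a)\<^sup>2 + 2 * (cmod b)\<^sup>2"
    using zero_le_power2[of "cmod a - cmod b"] by (simp add: power2_eq_square algebra_simps)
  finally show ?thesis .
qed

text \<open>With the factors 2 the parallelogram-type bound replaces the triangle inequality, which
  would need Minkowski's inequality for series.\<close>

lemma sq_norm_diff:
  assumes "A \<in> dirichlet_fps \<alpha>" "B \<in> dirichlet_fps \<alpha>"
  shows "A - B \<in> dirichlet_fps \<alpha>" "sq_norm \<alpha> (A - B) \<le> 2 * sq_norm \<alpha> A + 2 * sq_norm \<alpha> B"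
proof -
  let ?w = "\<lambda>k. (real k + 1) powr \<alpha>"
  let ?t = "\<lambda>A k. (cmod (fps_nth A k))\<^sup>2 * ?w k"
  have s: "summable (?t A)" "summable (?t B)" using assms by (auto simp: dirichlet_fps_def)
  have s2: "summable (\<lambda>k. 2 * ?t A k + 2 * ?t B k)"
    by (intro summable_add summable_mult s)
  have le: "?t (A - B) k \<le> 2 * ?t A k + 2 * ?t B k" for k
    using mult_right_mono[OF cmod_diff_squared_le[of "fps_nth A k" "fps_nth B k"], of "?w k"]
    by (simp add: algebra_simps)
  have s3: "summable (?t (A - B))"
    by (rule summable_comparison_test'[OF s2, of 0]) (use le in auto)
  then show "A - B \<in> dirichlet_fps \<alpha>" by (simp add: dirichlet_fps_def)
  have "sq_norm \<alpha> (A - B) \<le> (\<Sum>k. 2 * ?t A k + 2 * ?t B k)"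
    unfolding sq_norm_def by (intro suminf_le le s2 s3)
  also have "\<dots> = 2 * sq_norm \<alpha> A + 2 * sq_norm \<alpha> B"
    unfolding sq_norm_def using s by (simp add: suminf_add [symmetric] suminf_mult summable_mult)
  finally show "sq_norm \<alpha> (A - B) \<le> 2 * sq_norm \<alpha> A + 2 * sq_norm \<alpha> B" .
qed

lemma sq_norm_const_mult:
  assumes "A \<in> dirichlet_fps \<alpha>"
  shows "fps_const c * A \<in> dirichlet_fps \<alpha>"
    "sq_norm \<alpha> (fps_const c * A) = (cmod c)\<^sup>2 * sq_norm \<alpha> A"
proof -
  have s: "summable (\<lambda>k. (cmod (fps_nth A k))\<^sup>2 * (real k + 1) powr \<alpha>)"
    using assms by (simp add: dirichlet_fps_def)
  show "fps_const c * A \<in> dirichlet_fps \<alpha>"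
    using summable_mult[OF s, of "(cmod c)\<^sup>2"]
    by (simp add: dirichlet_fps_def norm_mult power_mult_distrib mult.assoc)
  show "sq_norm \<alpha> (fps_const c * A) = (cmod c)\<^sup>2 * sq_norm \<alpha> A"
    using suminf_mult[OF s, of "(cmod c)\<^sup>2"]
    by (simp add: sq_norm_def norm_mult power_mult_distrib mult.assoc)
qed

lemma sq_norm_add:
  assumes "A \<in> dirichlet_fps \<alpha>" "B \<in> dirichlet_fps \<alpha>"
  shows "A + B \<in> dirichlet_fps \<alpha>" "sq_norm \<alpha> (A + B) \<le> 2 * sq_norm \<alpha> A + 2 * sq_norm \<alpha> B"
  using sq_norm_diff[OF assms(1) sq_norm_const_mult(1)[OF assms(2), of "-1"]]
    sq_norm_const_mult(2)[OF assms(2), of "-1"]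
  by (simp_all flip: fps_const_neg)

lemma fps_of_poly_in_dirichlet: "fps_of_poly p \<in> dirichlet_fps \<alpha>"
proof -
  have "(cmod (coeff p k))\<^sup>2 * (real k + 1) powr \<alpha> = 0" if "k \<notin> {..degree p}" for k
    using that by (simp add: coeff_eq_0)
  from summable_finite[OF finite_atMost this] show ?thesis by (simp add: dirichlet_fps_def)
qed

text \<open>The shift replaces the weight base k+1 by k+2, and their ratio lies between 1 and 2. The
  absolute value in the exponent covers both signs of \<alpha>.\<close>

lemma sq_norm_fps_X_mult:
  assumes "A \<in> dirichlet_fps \<alpha>"
  shows "fps_X * A \<in> dirichlet_fps \<alpha>" "sq_norm \<alpha> (fps_X * A) \<le> 2 powr \<bar>\<alpha>\<bar> * sq_norm \<alpha> A"
proof -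
  let ?t = "\<lambda>A k. (cmod (fps_nth A k))\<^sup>2 * (real k + 1) powr \<alpha>"
  have s: "summable (?t A)" using assms by (simp add: dirichlet_fps_def)
  have w: "(real k + 2) powr \<alpha> \<le> 2 powr \<bar>\<alpha>\<bar> * (real k + 1) powr \<alpha>" for k
  proof -
    have "((real k + 2) / (real k + 1)) powr \<alpha> \<le> ((real k + 2) / (real k + 1)) powr \<bar>\<alpha>\<bar>"
      by (intro powr_mono) auto
    also have "\<dots> \<le> 2 powr \<bar>\<alpha>\<bar>"
      by (intro powr_mono2) (auto simp: field_simps)
    finally show ?thesis by (simp add: powr_divide field_simps)
  qed
  have le: "?t (fps_X * A) (Suc k) \<le> 2 powr \<bar>\<alpha>\<bar> * ?t A k" for k
    using mult_left_mono[OF w, of "(cmod (fps_nth A k))\<^sup>2" k] by (simp add: algebra_simps)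
  have s2: "summable (\<lambda>k. 2 powr \<bar>\<alpha>\<bar> * ?t A k)"
    by (intro summable_mult s)
  have s3: "summable (\<lambda>k. ?t (fps_X * A) (Suc k))"
    by (rule summable_comparison_test'[OF s2, of 0]) (use le in auto)
  then have s4: "summable (?t (fps_X * A))" by (subst (asm) summable_Suc_iff)
  then show "fps_X * A \<in> dirichlet_fps \<alpha>" by (simp add: dirichlet_fps_def)
  have "sq_norm \<alpha> (fps_X * A) = (\<Sum>k. ?t (fps_X * A) (Suc k))"
    unfolding sq_norm_def by (subst suminf_split_head[OF s4]) simp
  also have "\<dots> \<le> (\<Sum>k. 2 powr \<bar>\<alpha>\<bar> * ?t A k)"
    by (intro suminf_le le s2 s3)
  also have "\<dots> = 2 powr \<bar>\<alpha>\<bar> * sq_norm \<alpha> A"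
    unfolding sq_norm_def by (rule suminf_mult[OF s])
  finally show "sq_norm \<alpha> (fps_X * A) \<le> 2 powr \<bar>\<alpha>\<bar> * sq_norm \<alpha> A" .
qed

text \<open>Horner induction on p, with the induction hypothesis applied to
  \<open>fps_X * A\<close>. The constant is fixed before A, so it is uniform in A.\<close>

lemma sq_norm_poly_mult:
  obtains C where "C \<ge> 0"
    "\<And>A. A \<in> dirichlet_fps \<alpha> \<Longrightarrow>
       fps_of_poly p * A \<in> dirichlet_fps \<alpha> \<and> sq_norm \<alpha> (fps_of_poly p * A) \<le> C * sq_norm \<alpha> A"
proof -
  have "\<exists>C\<ge>0. \<forall>A\<in>dirichlet_fps \<alpha>.
       fps_of_poly p * A \<in> dirichlet_fps \<alpha> \<and> sq_norm \<alpha> (fps_of_poly p * A) \<le> C * sq_norm \<alpha> A"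
  proof (induction p)
    case 0
    show ?case
      by (rule exI[of _ 0]) (auto simp: dirichlet_fps_def sq_norm_def)
  next
    case (pCons c p)
    then obtain C where C: "C \<ge> 0" "\<And>A. A \<in> dirichlet_fps \<alpha> \<Longrightarrow> fps_of_poly p * A \<in> dirichlet_fps \<alpha>"
      "\<And>A. A \<in> dirichlet_fps \<alpha> \<Longrightarrow> sq_norm \<alpha> (fps_of_poly p * A) \<le> C * sq_norm \<alpha> A" by blast
    let ?D = "2 * (cmod c)\<^sup>2 + 2 * (C * 2 powr \<bar>\<alpha>\<bar>)"
    have "fps_of_poly (pCons c p) * A \<in> dirichlet_fps \<alpha> \<and>
        sq_norm \<alpha> (fps_of_poly (pCons c p) * A) \<le> ?D * sq_norm \<alpha> A"
      if A: "A \<in> dirichlet_fps \<alpha>" for A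
    proof -
      have eq: "fps_of_poly (pCons c p) * A = fps_const c * A + fps_of_poly p * (fps_X * A)"
        by (simp add: fps_of_poly_pCons algebra_simps)
      note cA = sq_norm_const_mult[OF A, of c] and XA = sq_norm_fps_X_mult[OF A]
      note pXA = C(2,3)[OF XA(1)]
      have "sq_norm \<alpha> (fps_of_poly p * (fps_X * A)) \<le> C * (2 powr \<bar>\<alpha>\<bar> * sq_norm \<alpha> A)"
        using pXA(2) mult_left_mono[OF XA(2) C(1)] by linarith
      then show ?thesis
        unfolding eq using sq_norm_add[OF cA(1) pXA(1)] cA(2) by (auto simp: algebra_simps)
    qed
    then show ?case using C(1) by (intro exI[of _ ?D]) auto
  qed
  then show ?thesis using that by blast
qed

text \<open>Subtracting a Taylor polynomial leaves exactly a tail of the convergent series that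
  defines the squared norm.\<close>

lemma fps_of_poly_dense:
  assumes A: "A \<in> dirichlet_fps \<alpha>" and "\<epsilon> > 0"
  obtains p where "sq_norm \<alpha> (A - fps_of_poly p) < \<epsilon>"
proof -
  let ?t = "\<lambda>A k. (cmod (fps_nth A k))\<^sup>2 * (real k + 1) powr \<alpha>"
  have "summable (?t A)" using A by (simp add: dirichlet_fps_def)
  from suminf_exist_split[OF \<open>\<epsilon> > 0\<close> this]
  obtain n where n: "norm (\<Sum>k. ?t A (k + n)) < \<epsilon>" by blast
  let ?B = "A - fps_of_poly (truncate_fps n A)"
  have "?B \<in> dirichlet_fps \<alpha>" by (intro sq_norm_diff A fps_of_poly_in_dirichlet)
  then have "sq_norm \<alpha> ?B = (\<Sum>k. ?t ?B (k + n)) + (\<Sum>k<n. ?t ?B k)"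
    unfolding sq_norm_def dirichlet_fps_def by (intro suminf_split_initial_segment) simp
  also have "\<dots> = (\<Sum>k. ?t A (k + n))" by simp
  finally show ?thesis using n that[of "truncate_fps n A"] by simp
qed

section \<open>Cyclicity as approximability of 1\<close>

text \<open>Only the constant 1 has to be approximated; \<open>cyclic_fps_approx\<close> extends
  this to the whole space.\<close>

definition cyclic_fps :: "real \<Rightarrow> complex fps \<Rightarrow> bool" where
  "cyclic_fps \<alpha> A \<longleftrightarrow> A \<in> dirichlet_fps \<alpha> \<and> (\<forall>\<epsilon>>0. \<exists>p. sq_norm \<alpha> (1 - fps_of_poly p * A) < \<epsilon>)"

text \<open>First G is approximated by a polynomial q, then q by q p A. The second error is q(1 -
  pA), and multiplication by q is bounded.\<close>

lemma cyclic_fps_approx: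
  assumes A: "cyclic_fps \<alpha> A" and G: "G \<in> dirichlet_fps \<alpha>" and "\<epsilon> > 0"
  obtains p where "sq_norm \<alpha> (G - fps_of_poly p * A) < \<epsilon>"
proof -
  have AS: "A \<in> dirichlet_fps \<alpha>" using A by (simp add: cyclic_fps_def)
  obtain q where q: "sq_norm \<alpha> (G - fps_of_poly q) < \<epsilon> / 4"
    using fps_of_poly_dense[OF G, of "\<epsilon> / 4"] \<open>\<epsilon> > 0\<close> by auto
  obtain C where C: "C \<ge> 0" "\<And>A. A \<in> dirichlet_fps \<alpha> \<Longrightarrow>
     fps_of_poly q * A \<in> dirichlet_fps \<alpha> \<and> sq_norm \<alpha> (fps_of_poly q * A) \<le> C * sq_norm \<alpha> A"
    using sq_norm_poly_mult[where p = q] by blast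
  \<comment> \<open>C + 1 avoids division by zero when C = 0. The 4 pays for two summands, each
    doubled by \<open>sq_norm_add\<close>.\<close>
  have "\<epsilon> / (4 * (C + 1)) > 0" using C(1) \<open>\<epsilon> > 0\<close> by simp
  then obtain p where p: "sq_norm \<alpha> (1 - fps_of_poly p * A) < \<epsilon> / (4 * (C + 1))"
    using A by (auto simp: cyclic_fps_def)
  have one: "1 \<in> dirichlet_fps \<alpha>" using fps_of_poly_in_dirichlet[of 1] by simp
  have pA: "fps_of_poly r * A \<in> dirichlet_fps \<alpha>" for r
    using sq_norm_poly_mult[where p = r] AS by blast
  let ?E = "1 - fps_of_poly p * A"
  have E: "?E \<in> dirichlet_fps \<alpha>" by (intro sq_norm_diff one pA)
  have Gq: "G - fps_of_poly q \<in> dirichlet_fps \<alpha>"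
    by (intro sq_norm_diff G fps_of_poly_in_dirichlet)
  have eq: "G - fps_of_poly (q * p) * A = (G - fps_of_poly q) + fps_of_poly q * ?E"
    by (simp add: fps_of_poly_mult algebra_simps)
  have "sq_norm \<alpha> (G - fps_of_poly (q * p) * A) \<le> 2 * sq_norm \<alpha> (G - fps_of_poly q) + 2 * sq_norm \<alpha> (fps_of_poly q * ?E)"
    unfolding eq using sq_norm_add[OF Gq] C(2)[OF E] by blast
  moreover have "sq_norm \<alpha> (fps_of_poly q * ?E) \<le> C * sq_norm \<alpha> ?E" using C(2)[OF E] by blast
  moreover have "C * sq_norm \<alpha> ?E \<le> (C + 1) * sq_norm \<alpha> ?E"
    using sq_norm_nonneg[OF E] by (simp add: algebra_simps)
  moreover have "(C + 1) * sq_norm \<alpha> ?E < \<epsilon> / 4"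
    using p C(1) by (simp add: field_simps)
  ultimately have "sq_norm \<alpha> (G - fps_of_poly (q * p) * A) < \<epsilon>" using q by linarith
  then show ?thesis by (rule that)
qed

section \<open>Transfer between functions on the disc and their power series\<close>

lemma has_fps_expansion_poly: "poly p has_fps_expansion fps_of_poly (p :: complex poly)"
proof (induction p)
  case 0
  show ?case by (simp add: zero_fun_def)
next
  case (pCons c p)
  have "(\<lambda>z. c + poly p z * z) has_fps_expansion (fps_const c + fps_of_poly p * fps_X)"
    by (intro fps_expansion_intros pCons)
  then show ?case by (simp add: fps_of_poly_pCons poly_pCons mult.commute fun_eq_iff[symmetric])
qed

lemma dirichlet_space_iff:
  "f \<in> dirichlet_space \<alpha> \<longleftrightarrow> f analytic_on ball 0 1 \<and> fps_expansion f 0 \<in> dirichlet_fps \<alpha>"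
  by (simp add: dirichlet_space_def dirichlet_fps_def taylor_coeff_def)

lemma dirichlet_norm_eq: "dirichlet_norm \<alpha> f = sqrt (sq_norm \<alpha> (fps_expansion f 0))"
  by (simp add: dirichlet_norm_def sq_norm_def taylor_coeff_def)

lemma dirichlet_space_has_fps_expansion:
  "f \<in> dirichlet_space \<alpha> \<Longrightarrow> f has_fps_expansion fps_expansion f 0"
  by (intro analytic_at_imp_has_fps_expansion_0) (auto simp: dirichlet_space_iff analytic_on_def)

lemma fps_expansion_diff:
  assumes "f \<in> dirichlet_space \<alpha>" "g \<in> dirichlet_space \<alpha>"
  shows "fps_expansion (f - g) 0 = fps_expansion f 0 - fps_expansion g 0"
  unfolding fun_diff_def
  by (intro fps_expansion_eqI fps_expansion_intros dirichlet_space_has_fps_expansion[of _ \<alpha>] assms)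

lemma fps_expansion_diff_poly_mult:
  assumes "f \<in> dirichlet_space \<alpha>" "g \<in> dirichlet_space \<alpha>"
  shows "fps_expansion (g - (\<lambda>z. poly p z * f z)) 0 = fps_expansion g 0 - fps_of_poly p * fps_expansion f 0"
  unfolding fun_diff_def
  by (intro fps_expansion_eqI fps_expansion_intros dirichlet_space_has_fps_expansion[of _ \<alpha>] assms
      has_fps_expansion_poly)

lemma poly_in_dirichlet_space: "poly p \<in> dirichlet_space \<alpha>"
proof -
  have "poly p analytic_on ball 0 1"
    by (subst analytic_on_open) (auto intro!: holomorphic_intros)
  then show ?thesis
    by (simp add: dirichlet_space_iff fps_expansion_eqI[OF has_fps_expansion_poly]
        fps_of_poly_in_dirichlet)
qed

text \<open>Replaces the search for a span element by the search for a single polynomial multiplier,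
  as in \<open>cyclic_fps\<close>.\<close>

lemma span_monomial_multiples:
  "complex_fun.span (range (\<lambda>(k::nat) z. z ^ k * f z)) = range (\<lambda>p z. poly p z * f z)"
proof (intro equalityI subsetI)
  fix h assume "h \<in> complex_fun.span (range (\<lambda>(k::nat) z. z ^ k * f z))"
  then show "h \<in> range (\<lambda>p z. poly p z * f z)"
  proof (induction rule: complex_fun.span_induct_alt)
    case base
    show ?case by (rule image_eqI[of _ _ 0]) (auto simp: fun_eq_iff)
  next
    case (step c x y)
    then obtain k p where "x = (\<lambda>z. z ^ k * f z)" "y = (\<lambda>z. poly p z * f z)" by auto
    then show ?case
      by (intro image_eqI[of _ _ "monom c k + p"]) (auto simp: fun_eq_iff poly_monom algebra_simps)
  qed
next
  fix h assume "h \<in> range (\<lambda>p z. poly p z * f z)"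
  then obtain p where h: "h = (\<lambda>z. poly p z * f z)" by auto
  have sum_fun: "(\<Sum>i\<in>I. g i) z = (\<Sum>i\<in>I. g i z)" if "finite I"
    for I :: "nat set" and g :: "nat \<Rightarrow> complex \<Rightarrow> complex" and z
    using that by induction auto
  have "h = (\<Sum>i\<le>degree p. (\<lambda>z. coeff p i * (z ^ i * f z)))"
    by (auto simp: h fun_eq_iff sum_fun poly_altdef sum_distrib_right mult.assoc)
  also have "\<dots> \<in> complex_fun.span (range (\<lambda>(k::nat) z. z ^ k * f z))"
    by (intro complex_fun.span_sum complex_fun.span_scale complex_fun.span_base) auto
  finally show "h \<in> complex_fun.span (range (\<lambda>(k::nat) z. z ^ k * f z))" .
qed

text \<open>One direction tests the closed span on the constant function 1; the other is
  \<open>cyclic_fps_approx\<close>. The thresholds \<open>sqrt \<epsilon>\<close> and \<epsilon>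
  squared translate between the norm and its square.\<close>

lemma cyclic_fun_iff:
  assumes f: "f \<in> dirichlet_space \<alpha>"
  shows "cyclic_fun \<alpha> f \<longleftrightarrow> cyclic_fps \<alpha> (fps_expansion f 0)"
proof
  let ?A = "fps_expansion f 0"
  have A: "?A \<in> dirichlet_fps \<alpha>" using f by (simp add: dirichlet_space_iff)
  have one: "(\<lambda>z. 1) \<in> dirichlet_space \<alpha>" "fps_expansion (\<lambda>z. 1) 0 = (1 :: complex fps)"
    using poly_in_dirichlet_space[of 1] fps_expansion_eqI[OF has_fps_expansion_poly[of 1]]
    by (simp_all add: poly_1[abs_def])
  show "cyclic_fps \<alpha> ?A" if "cyclic_fun \<alpha> f"
    unfolding cyclic_fps_def
  proof (intro conjI A allI impI)
    fix \<epsilon> :: real assume "\<epsilon> > 0"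
    have "(\<lambda>z. 1) \<in> dirichlet_closed_span \<alpha> (range (\<lambda>(k::nat) z. z ^ k * f z))"
      using that one(1) by (simp add: cyclic_fun_def)
    then obtain p where "dirichlet_norm \<alpha> ((\<lambda>z. 1) - (\<lambda>z. poly p z * f z)) < sqrt \<epsilon>"
      using \<open>\<epsilon> > 0\<close> unfolding dirichlet_closed_span_def span_monomial_multiples
      by (auto dest!: spec[of _ "sqrt \<epsilon>"])
    then show "\<exists>p. sq_norm \<alpha> (1 - fps_of_poly p * ?A) < \<epsilon>"
      unfolding dirichlet_norm_eq fps_expansion_diff_poly_mult[OF f one(1)] one(2) by auto
  qed
  show "cyclic_fun \<alpha> f" if cyc: "cyclic_fps \<alpha> ?A"
  proof -
    have "\<exists>h\<in>range (\<lambda>p z. poly p z * f z). dirichlet_norm \<alpha> (g - h) < \<epsilon>"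
      if g: "g \<in> dirichlet_space \<alpha>" and "\<epsilon> > 0" for g \<epsilon>
    proof -
      obtain p where "sq_norm \<alpha> (fps_expansion g 0 - fps_of_poly p * ?A) < \<epsilon>\<^sup>2"
        using cyclic_fps_approx[OF cyc, of "fps_expansion g 0" "\<epsilon>\<^sup>2"] g \<open>\<epsilon> > 0\<close>
        by (auto simp: dirichlet_space_iff)
      then have "dirichlet_norm \<alpha> (g - (\<lambda>z. poly p z * f z)) < \<epsilon>"
        unfolding dirichlet_norm_eq fps_expansion_diff_poly_mult[OF f g]
        using \<open>\<epsilon> > 0\<close> by (intro real_less_lsqrt) auto
      then show ?thesis by blast
    qed
    then show ?thesis
      using f unfolding cyclic_fun_def dirichlet_closed_span_def span_monomial_multiples by blast
  qed
qed

section \<open>The case \<open>\<alpha> > 1\<close>\<close>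

text \<open>Cauchy-Schwarz separates each coefficient of the product into a kernel sum of reciprocal
  weights and a Cauchy product of the weighted squares. The kernel is bounded uniformly in n because
  the reciprocal weights are summable for \<alpha> > 1.\<close>

lemma sq_norm_mult:
  assumes "\<alpha> > 1"
  obtains K where "K > 0"
    "\<And>A B. \<lbrakk>A \<in> dirichlet_fps \<alpha>; B \<in> dirichlet_fps \<alpha>\<rbrakk> \<Longrightarrow> A * B \<in> dirichlet_fps \<alpha>"
    "\<And>A B. \<lbrakk>A \<in> dirichlet_fps \<alpha>; B \<in> dirichlet_fps \<alpha>\<rbrakk> \<Longrightarrow>
       sq_norm \<alpha> (A * B) \<le> K * (sq_norm \<alpha> A * sq_norm \<alpha> B)"
proof -
  define v where "v = (\<lambda>k. (real k + 1) powr -\<alpha>)"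
  let ?w = "\<lambda>k. (real k + 1) powr \<alpha>"
  have "summable (\<lambda>n. of_nat n powr -\<alpha> :: real)"
    using assms by (subst summable_real_powr_iff) auto
  then have v: "summable v"
    unfolding v_def using summable_Suc_iff[of "\<lambda>n. of_nat n powr -\<alpha> :: real"] by (simp add: add_ac)
  have v_nonneg: "v k \<ge> 0" for k by (simp add: v_def)
  have vw: "v k * ?w k = 1" for k by (simp add: v_def powr_minus field_simps)
  define V where "V = suminf v"
  have "V > 0" unfolding V_def by (rule suminf_pos[OF v]) (simp add: v_def)
  \<comment> \<open>The factor \<open>2 powr \<alpha>\<close> comes from comparing n+1 with twice a
    maximum, and 2V from two sums of v, each at most V.\<close>
  define K where "K = 2 powr \<alpha> * (2 * V)"
  have "K > 0" using \<open>V > 0\<close> by (simp add: K_def)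

  have kernel: "(\<Sum>i\<le>n. v i * v (n - i)) * ?w n \<le> K" for n
  proof -
    have "v i * v (n - i) * ?w n \<le> 2 powr \<alpha> * (v i + v (n - i))" if "i \<le> n" for i
    proof -
      \<comment> \<open>n+1 is less than (i+1) + (n-i+1), hence at most twice the larger summand. A
        power of the maximum is then bounded by the sum of both powers, and each weight cancels its
        own v.\<close>
      have "?w n \<le> (2 * max (real i + 1) (real (n - i) + 1)) powr \<alpha>"
        using that assms by (intro powr_mono2) (auto simp: max_def)
      also have "\<dots> = 2 powr \<alpha> * (max (real i + 1) (real (n - i) + 1)) powr \<alpha>"
        by (simp add: powr_mult)
      also have "\<dots> \<le> 2 powr \<alpha> * (?w i + ?w (n - i))"
        by (intro mult_left_mono) (auto simp: max_def)
      finally have "v i * v (n - i) * ?w n \<le> v i * v (n - i) * (2 powr \<alpha> * (?w i + ?w (n - i)))"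
        using v_nonneg by (intro mult_left_mono) auto
      also have "\<dots> = 2 powr \<alpha> * ((v i * ?w i) * v (n - i) + v i * (v (n - i) * ?w (n - i)))"
        by (simp only: algebra_simps)
      finally show ?thesis unfolding vw by (simp add: add.commute)
    qed
    then have "(\<Sum>i\<le>n. v i * v (n - i)) * ?w n \<le> (\<Sum>i\<le>n. 2 powr \<alpha> * (v i + v (n - i)))"
      unfolding sum_distrib_right by (intro sum_mono) auto
    also have "\<dots> = 2 powr \<alpha> * ((\<Sum>i\<le>n. v i) + (\<Sum>i\<le>n. v (n - i)))"
      by (subst sum_distrib_left[symmetric]) (subst sum.distrib, rule refl)
    also have "(\<Sum>i\<le>n. v (n - i)) = (\<Sum>i\<le>n. v i)"
      using sum.nat_diff_reindex[of v "Suc n"] by (simp add: lessThan_Suc_atMost)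
    also have "(\<Sum>i\<le>n. v i) \<le> V"
      unfolding V_def by (rule sum_le_suminf[OF v]) (auto simp: v_nonneg)
    finally show ?thesis by (simp add: K_def)
  qed

  let ?t = "\<lambda>A k. (cmod (fps_nth A k))\<^sup>2 * ?w k"
  have conv: "?t (A * B) n \<le> K * (\<Sum>i\<le>n. ?t A i * ?t B (n - i))" for A B n
  proof -
    have "cmod (fps_nth (A * B) n) \<le> (\<Sum>i\<le>n. cmod (fps_nth A i) * cmod (fps_nth B (n - i)))"
      unfolding fps_mult_nth atMost_atLeast0 norm_mult[symmetric] by (rule norm_sum)
    \<comment> \<open>Since v is the reciprocal of the weight, inserting both changes nothing, but
      it puts the sum in the form for Cauchy-Schwarz.\<close>
    also have "\<dots> = (\<Sum>i\<le>n. sqrt (v i * v (n - i)) * sqrt (?t A i * ?t B (n - i)))"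
    proof (intro sum.cong refl)
      fix i
      have "v i * v (n - i) * (?t A i * ?t B (n - i)) =
          (v i * ?w i) * (v (n - i) * ?w (n - i)) * (cmod (fps_nth A i) * cmod (fps_nth B (n - i)))\<^sup>2"
        by (simp add: power_mult_distrib algebra_simps)
      then have "v i * v (n - i) * (?t A i * ?t B (n - i)) =
          (cmod (fps_nth A i) * cmod (fps_nth B (n - i)))\<^sup>2"
        by (simp only: vw mult_1)
      then show "cmod (fps_nth A i) * cmod (fps_nth B (n - i)) =
          sqrt (v i * v (n - i)) * sqrt (?t A i * ?t B (n - i))"
        unfolding real_sqrt_mult[symmetric] by simp
    qed
    finally have "(cmod (fps_nth (A * B) n))\<^sup>2 \<le>
        (\<Sum>i\<le>n. sqrt (v i * v (n - i)) * sqrt (?t A i * ?t B (n - i)))\<^sup>2"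
      by (intro power_mono) auto
    also have "\<dots> \<le> (\<Sum>i\<le>n. (sqrt (v i * v (n - i)))\<^sup>2) * (\<Sum>i\<le>n. (sqrt (?t A i * ?t B (n - i)))\<^sup>2)"
      by (rule Cauchy_Schwarz_ineq_sum)
    also have "\<dots> = (\<Sum>i\<le>n. v i * v (n - i)) * (\<Sum>i\<le>n. ?t A i * ?t B (n - i))"
      using v_nonneg by (simp add: real_sqrt_pow2)
    finally have "?t (A * B) n \<le> (\<Sum>i\<le>n. v i * v (n - i)) * (\<Sum>i\<le>n. ?t A i * ?t B (n - i)) * ?w n"
      by (intro mult_right_mono) auto
    also have "\<dots> = (\<Sum>i\<le>n. v i * v (n - i)) * ?w n * (\<Sum>i\<le>n. ?t A i * ?t B (n - i))"
      by (simp only: mult_ac)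
    also have "\<dots> \<le> K * (\<Sum>i\<le>n. ?t A i * ?t B (n - i))"
      by (intro mult_right_mono kernel sum_nonneg) auto
    finally show ?thesis .
  qed

  have "A * B \<in> dirichlet_fps \<alpha> \<and> sq_norm \<alpha> (A * B) \<le> K * (sq_norm \<alpha> A * sq_norm \<alpha> B)"
    if "A \<in> dirichlet_fps \<alpha>" "B \<in> dirichlet_fps \<alpha>" for A B
  proof -
    have s: "summable (\<lambda>k. norm (?t A k))" "summable (\<lambda>k. norm (?t B k))"
      using that by (auto simp: dirichlet_fps_def)
    let ?c = "\<lambda>n. \<Sum>i\<le>n. ?t A i * ?t B (n - i)"
    have c: "summable ?c" by (rule summable_Cauchy_product[OF s])
    have s2: "summable (\<lambda>n. K * ?c n)" by (intro summable_mult c)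
    have s3: "summable (?t (A * B))"
      by (rule summable_comparison_test'[OF s2, of 0]) (use conv in auto)
    have "sq_norm \<alpha> (A * B) \<le> (\<Sum>n. K * ?c n)"
      unfolding sq_norm_def by (intro suminf_le conv s2 s3)
    also have "\<dots> = K * (\<Sum>n. ?c n)" by (rule suminf_mult[OF c])
    \<comment> \<open>Summed over n, the convolutions form the Cauchy product of two absolutely
      convergent series, so the sum factorises.\<close>
    also have "(\<Sum>n. ?c n) = sq_norm \<alpha> A * sq_norm \<alpha> B"
      unfolding sq_norm_def by (rule Cauchy_product[OF s, symmetric])
    finally show ?thesis using s3 by (simp add: dirichlet_fps_def)
  qed
  then show ?thesis using that \<open>K > 0\<close> by blast
qed

text \<open>Newton's step \<open>p \<mapsto> 2p - p\<^sup>2A\<close> for inverting \<open>A\<close> squares the error \<open>1 - pA\<close>. Hence the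
  infimum \<open>d\<close> of the attainable errors satisfies \<open>d \<le> 2Kd\<^sup>2\<close>, and a small \<open>d\<close> must vanish.\<close>

lemma cyclic_fps_of_close_to_1:
  assumes "\<alpha> > 1"
  obtains \<delta> where "\<delta> > 0"
    "\<And>A p. \<lbrakk>A \<in> dirichlet_fps \<alpha>; sq_norm \<alpha> (1 - fps_of_poly p * A) < \<delta>\<rbrakk> \<Longrightarrow> cyclic_fps \<alpha> A"
proof -
  obtain K where K: "K > 0"
    "\<And>A B. \<lbrakk>A \<in> dirichlet_fps \<alpha>; B \<in> dirichlet_fps \<alpha>\<rbrakk> \<Longrightarrow> A * B \<in> dirichlet_fps \<alpha>"
    "\<And>A B. \<lbrakk>A \<in> dirichlet_fps \<alpha>; B \<in> dirichlet_fps \<alpha>\<rbrakk> \<Longrightarrow>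
       sq_norm \<alpha> (A * B) \<le> K * (sq_norm \<alpha> A * sq_norm \<alpha> B)"
    using sq_norm_mult[OF assms] by blast
  have one: "1 \<in> dirichlet_fps \<alpha>" using fps_of_poly_in_dirichlet[of 1] by simp
  \<comment> \<open>A positive d with d \<le> 2K d^2 would be at least 1/(2K), which is therefore
    the threshold. K depends only on \<alpha>, so the threshold serves every A and p.\<close>
  have "cyclic_fps \<alpha> A"
    if A: "A \<in> dirichlet_fps \<alpha>" and small: "sq_norm \<alpha> (1 - fps_of_poly p0 * A) < 1 / (2 * K)" for A p0
  proof -
    define err where "err = (\<lambda>p. sq_norm \<alpha> (1 - fps_of_poly p * A))"
    have E: "1 - fps_of_poly p * A \<in> dirichlet_fps \<alpha>" for p
      by (intro sq_norm_diff one K(2) fps_of_poly_in_dirichlet A)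
    have err_nonneg: "err p \<ge> 0" for p unfolding err_def by (rule sq_norm_nonneg[OF E])
    define d where "d = (INF p. err p)"
    have bdd: "bdd_below (range err)" using err_nonneg by (intro bdd_belowI[of _ 0]) auto
    have d_le: "d \<le> err p" for p unfolding d_def by (rule cINF_lower[OF bdd]) simp
    have "d \<ge> 0" unfolding d_def using err_nonneg by (intro cINF_greatest) auto
    \<comment> \<open>The Newton iterate 2p - p^2 A is not a polynomial in general. Replacing p^2 A
      by a nearby polynomial r costs an arbitrarily small \<epsilon>.\<close>
    have newton: "d \<le> 2 * K * (err p)\<^sup>2" for p
    proof (rule field_le_epsilon)
      fix \<epsilon> :: real assume "\<epsilon> > 0"
      let ?P = "fps_of_poly p" let ?N = "sq_norm \<alpha> A"
      have N: "?N \<ge> 0" by (rule sq_norm_nonneg[OF A])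
      have P2: "?P * ?P * A \<in> dirichlet_fps \<alpha>"
        by (intro K(2) fps_of_poly_in_dirichlet A)
      \<comment> \<open>Chosen so that the doubled squared norm of \<open>?R * A\<close>, at most 2K
        times the product of the two squared norms, stays below \<epsilon>.\<close>
      have "\<epsilon> / (2 * K * (?N + 1)) > 0" using \<open>\<epsilon> > 0\<close> K(1) N by simp
      from fps_of_poly_dense[OF P2 this]
      obtain r where r: "sq_norm \<alpha> (?P * ?P * A - fps_of_poly r) < \<epsilon> / (2 * K * (?N + 1))" by blast
      let ?R = "?P * ?P * A - fps_of_poly r"
      have R: "?R \<in> dirichlet_fps \<alpha>" by (intro sq_norm_diff P2 fps_of_poly_in_dirichlet)
      have "1 - fps_of_poly (2 * p - r) * A = (1 - ?P * A) * (1 - ?P * A) - ?R * A"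
        by (simp add: fps_of_poly_diff fps_of_poly_mult algebra_simps)
      then have "err (2 * p - r) \<le>
          2 * sq_norm \<alpha> ((1 - ?P * A) * (1 - ?P * A)) + 2 * sq_norm \<alpha> (?R * A)"
        unfolding err_def using sq_norm_diff(2)[OF K(2)[OF E E] K(2)[OF R A]] by simp
      moreover have "sq_norm \<alpha> ((1 - ?P * A) * (1 - ?P * A)) \<le> K * (err p)\<^sup>2"
        using K(3)[OF E E] by (simp add: err_def power2_eq_square)
      moreover have "2 * sq_norm \<alpha> (?R * A) \<le> \<epsilon>"
      proof -
        have "sq_norm \<alpha> (?R * A) \<le> K * (sq_norm \<alpha> ?R * ?N)" by (rule K(3)[OF R A])
        also have "\<dots> \<le> K * (sq_norm \<alpha> ?R * (?N + 1))"
          using K(1) sq_norm_nonneg[OF R] by (intro mult_left_mono) auto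
        moreover have "sq_norm \<alpha> ?R * (2 * K * (?N + 1)) < \<epsilon>"
          using r K(1) N by (subst (asm) pos_less_divide_eq) auto
        ultimately show ?thesis by (simp only: mult_ac)
      qed
      ultimately show "d \<le> 2 * K * (err p)\<^sup>2 + \<epsilon>" using d_le[of "2 * p - r"] by linarith
    qed
    have "d \<le> 0"
    proof (rule ccontr)
      assume "\<not> d \<le> 0"
      then have "d > 0" by simp
      \<comment> \<open>The Newton bound is solved for \<open>err p\<close>, so that the infimum
        over p can be taken on the right.\<close>
      have "sqrt (d / (2 * K)) \<le> err p" for p
        using newton[of p] K(1) err_nonneg[of p] by (intro real_le_lsqrt) (auto simp: field_simps)
      then have "sqrt (d / (2 * K)) \<le> d"
        unfolding d_def by (intro cINF_greatest) auto
      then have "d / (2 * K) \<le> d * d"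
        using \<open>d > 0\<close> by (auto dest: sqrt_le_D simp: power2_eq_square)
      then have "1 / (2 * K) \<le> d"
        using \<open>d > 0\<close> K(1) by (simp add: field_simps)
      then show False using d_le[of p0] small by (simp add: err_def)
    qed
    show ?thesis unfolding cyclic_fps_def
    proof (intro conjI A allI impI)
      fix \<epsilon> :: real assume "\<epsilon> > 0"
      then have "(INF p. err p) < \<epsilon>" using \<open>d \<le> 0\<close> by (simp add: d_def)
      then show "\<exists>p. sq_norm \<alpha> (1 - fps_of_poly p * A) < \<epsilon>"
        using cINF_less_iff[OF _ bdd] by (auto simp: err_def)
    qed
  qed
  then show ?thesis using that[of "1 / (2 * K)"] K(1) by auto
qed

text \<open>A multiplier p that brings pg close to 1 also works for \<open>F n\<close> near g,
  because 1 - pF differs from 1 - pg by p(F - g). The fixed threshold then makes \<open>F n\<close>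
  cyclic.\<close>

lemma cyclic_fun_open:
  assumes "\<alpha> > 1" and lim: "dirichlet_converges \<alpha> F g" and g: "cyclic_fun \<alpha> g"
  shows "\<exists>n. cyclic_fun \<alpha> (F n)"
proof -
  have FS: "F n \<in> dirichlet_space \<alpha>" and gS: "g \<in> dirichlet_space \<alpha>" for n
    using lim by (auto simp: dirichlet_converges_def)
  obtain \<delta> where \<delta>: "\<delta> > 0"
    "\<And>A p. \<lbrakk>A \<in> dirichlet_fps \<alpha>; sq_norm \<alpha> (1 - fps_of_poly p * A) < \<delta>\<rbrakk> \<Longrightarrow> cyclic_fps \<alpha> A"
    using cyclic_fps_of_close_to_1[OF \<open>\<alpha> > 1\<close>] by blast
  let ?G = "fps_expansion g 0" and ?F = "\<lambda>n. fps_expansion (F n) 0"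
  have G: "?G \<in> dirichlet_fps \<alpha>" and F: "?F n \<in> dirichlet_fps \<alpha>" for n
    using FS gS by (auto simp: dirichlet_space_iff)
  have "cyclic_fps \<alpha> ?G" using g gS by (simp add: cyclic_fun_iff)
  then obtain p where p: "sq_norm \<alpha> (1 - fps_of_poly p * ?G) < \<delta> / 4"
    using \<delta>(1) by (auto simp: cyclic_fps_def dest!: spec[of _ "\<delta> / 4"])
  obtain C where C: "C \<ge> 0" "\<And>A. A \<in> dirichlet_fps \<alpha> \<Longrightarrow>
     fps_of_poly p * A \<in> dirichlet_fps \<alpha> \<and> sq_norm \<alpha> (fps_of_poly p * A) \<le> C * sq_norm \<alpha> A"
    using sq_norm_poly_mult[where p = p] by blast
  \<comment> \<open>Makes the perturbation p(F - g) contribute less than \<delta>/4 before doubling,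
    the same share as 1 - pg.\<close>
  define \<eta> where "\<eta> = \<delta> / (4 * (C + 1))"
  have "\<eta> > 0" using \<delta>(1) C(1) by (simp add: \<eta>_def)
  have "(\<lambda>n. dirichlet_norm \<alpha> (F n - g)) \<longlonglongrightarrow> 0"
    using lim by (simp add: dirichlet_converges_def)
  then have "eventually (\<lambda>n. dirichlet_norm \<alpha> (F n - g) < sqrt \<eta>) sequentially"
    using \<open>\<eta> > 0\<close> by (intro order_tendstoD(2)) auto
  then obtain n where n: "sq_norm \<alpha> (?F n - ?G) < \<eta>"
    unfolding dirichlet_norm_eq fps_expansion_diff[OF FS gS] by (auto dest: eventually_happens)
  have one: "1 \<in> dirichlet_fps \<alpha>" using fps_of_poly_in_dirichlet[of 1] by simp
  have D: "?F n - ?G \<in> dirichlet_fps \<alpha>" by (intro sq_norm_diff F G)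
  have E: "1 - fps_of_poly p * ?G \<in> dirichlet_fps \<alpha>"
    using C(2)[OF G] by (intro sq_norm_diff one) auto
  have eq: "1 - fps_of_poly p * ?F n = (1 - fps_of_poly p * ?G) - fps_of_poly p * (?F n - ?G)"
    by (simp add: algebra_simps)
  have "sq_norm \<alpha> (1 - fps_of_poly p * ?F n) \<le>
      2 * sq_norm \<alpha> (1 - fps_of_poly p * ?G) + 2 * sq_norm \<alpha> (fps_of_poly p * (?F n - ?G))"
    unfolding eq using C(2)[OF D] by (intro sq_norm_diff(2) E) auto
  moreover have "sq_norm \<alpha> (fps_of_poly p * (?F n - ?G)) \<le> C * sq_norm \<alpha> (?F n - ?G)"
    using C(2)[OF D] by blast
  moreover have "C * sq_norm \<alpha> (?F n - ?G) \<le> (C + 1) * sq_norm \<alpha> (?F n - ?G)"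
    using sq_norm_nonneg[OF D] by (simp add: algebra_simps)
  moreover have "(C + 1) * sq_norm \<alpha> (?F n - ?G) < \<delta> / 4"
    using n C(1) by (simp add: \<eta>_def field_simps)
  ultimately have "sq_norm \<alpha> (1 - fps_of_poly p * ?F n) < \<delta>" using p by linarith
  then have "cyclic_fps \<alpha> (?F n)" by (rule \<delta>(2)[OF F])
  then show ?thesis using FS cyclic_fun_iff by blast
qed

section \<open>The case \<open>\<alpha> \<le> 1\<close>\<close>

lemma sq_norm_fps_of_poly:
  "sq_norm \<alpha> (fps_of_poly p) = (\<Sum>k\<le>degree p. (cmod (coeff p k))\<^sup>2 * (real k + 1) powr \<alpha>)"
  unfolding sq_norm_def fps_of_poly_nth by (rule suminf_finite) (auto simp: coeff_eq_0)

lemma summable_power_mult_powr: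
  fixes r s :: real
  assumes "0 < r" "r < 1"
  shows "summable (\<lambda>k. r ^ k * (real k + 1) powr s)"
proof (rule summable_comparison_test_bigo)
  show "summable (\<lambda>n. norm (real n powr -2))"
    using summable_real_powr_iff[of "-2"] by simp
  have "ln r < 0" using assms by simp
  \<comment> \<open>The power is written as an exponential with negative rate, which beats every
    power of k.\<close>
  then have "(\<lambda>k. exp (ln r * real k) * (real k + 1) powr s) \<in> O(\<lambda>n. real n powr -2)"
    by real_asymp
  also have "(\<lambda>k. exp (ln r * real k)) = (\<lambda>k. r ^ k)"
    using assms by (simp add: exp_of_nat_mult mult.commute[of "ln r"])
  finally show "(\<lambda>k. r ^ k * (real k + 1) powr s) \<in> O(\<lambda>n. real n powr -2)" by simp
qed

text \<open>Cauchy-Schwarz with the weight split evenly between the powers of w and the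
  coefficients. The constant is the squared norm of the reproducing kernel at w, finite because
  \<open>cmod w < 1\<close>.\<close>

lemma poly_eval_bounded:
  assumes "w \<noteq> 0" "cmod w < 1"
  obtains C where "C > 0" "\<And>p. (cmod (poly p w))\<^sup>2 \<le> C * sq_norm \<alpha> (fps_of_poly p)"
proof -
  let ?u = "\<lambda>k. ((cmod w)\<^sup>2) ^ k * (real k + 1) powr -\<alpha>"
  have u: "summable ?u"
    using assms by (intro summable_power_mult_powr) (auto simp: power_less_one_iff)
  have "suminf ?u > 0" using assms by (intro suminf_pos u) auto
  moreover have "(cmod (poly p w))\<^sup>2 \<le> suminf ?u * sq_norm \<alpha> (fps_of_poly p)" for p
  proof -
    let ?a = "\<lambda>k. cmod w ^ k * (real k + 1) powr (-\<alpha>/2)"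
    let ?b = "\<lambda>k. cmod (coeff p k) * (real k + 1) powr (\<alpha>/2)"
    have sq: "(x powr (s/2))\<^sup>2 = x powr s" if "x > 0" for x s :: real
      using that by (simp add: power2_eq_square flip: powr_add)
    have "cmod (poly p w) \<le> (\<Sum>k\<le>degree p. cmod (coeff p k) * cmod w ^ k)"
      unfolding poly_altdef by (rule sum_norm_le) (simp add: norm_mult norm_power)
    also have "\<dots> = (\<Sum>k\<le>degree p. ?a k * ?b k)"
      by (intro sum.cong refl) (simp add: powr_minus field_simps)
    finally have "(cmod (poly p w))\<^sup>2 \<le> (\<Sum>k\<le>degree p. ?a k * ?b k)\<^sup>2"
      by (intro power_mono) auto
    also have "\<dots> \<le> (\<Sum>k\<le>degree p. (?a k)\<^sup>2) * (\<Sum>k\<le>degree p. (?b k)\<^sup>2)"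
      by (rule Cauchy_Schwarz_ineq_sum)
    also have "(\<Sum>k\<le>degree p. (?b k)\<^sup>2) = sq_norm \<alpha> (fps_of_poly p)"
      unfolding sq_norm_fps_of_poly by (intro sum.cong refl) (simp add: power_mult_distrib sq)
    also have "(\<Sum>k\<le>degree p. (?a k)\<^sup>2) = (\<Sum>k\<le>degree p. ?u k)"
      using sq[of _ "-\<alpha>"]
      by (intro sum.cong refl) (simp add: power_mult_distrib mult.commute flip: power_mult)
    also have "\<dots> * sq_norm \<alpha> (fps_of_poly p) \<le> suminf ?u * sq_norm \<alpha> (fps_of_poly p)"
      by (intro mult_right_mono sum_le_suminf u sq_norm_nonneg fps_of_poly_in_dirichlet) auto
    finally show ?thesis .
  qed
  ultimately show ?thesis using that by blast
qed

section \<open>Cyclic and non-cyclic polynomials\<close>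

lemma cyclic_fun_poly_iff:
  "cyclic_fun \<alpha> (poly p) \<longleftrightarrow> (\<forall>\<epsilon>>0. \<exists>q. sq_norm \<alpha> (fps_of_poly (1 - q * p)) < \<epsilon>)"
  by (simp add: cyclic_fun_iff[OF poly_in_dirichlet_space] fps_expansion_eqI[OF has_fps_expansion_poly]
      cyclic_fps_def fps_of_poly_in_dirichlet fps_of_poly_diff fps_of_poly_mult)

text \<open>Every 1 - qp takes the value 1 at the zero w, so bounded evaluation keeps its squared
  norm at least 1/C.\<close>

lemma not_cyclic_poly_zero_in_disc:
  assumes "poly p w = 0" "w \<noteq> 0" "cmod w < 1"
  shows "\<not> cyclic_fun \<alpha> (poly p)"
proof
  assume cyc: "cyclic_fun \<alpha> (poly p)"
  obtain C where C: "C > 0" "\<And>p. (cmod (poly p w))\<^sup>2 \<le> C * sq_norm \<alpha> (fps_of_poly p)"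
    using poly_eval_bounded assms by blast
  obtain q where "sq_norm \<alpha> (fps_of_poly (1 - q * p)) < 1 / C"
    using cyc C(1) unfolding cyclic_fun_poly_iff by (auto dest!: spec[of _ "1 / C"])
  moreover have "1 \<le> C * sq_norm \<alpha> (fps_of_poly (1 - q * p))"
    using C(2)[of "1 - q * p"] assms by simp
  ultimately show False using C(1) by (simp add: field_simps)
qed

text \<open>Every polynomial \<open>r\<close> with \<open>r(1) = 1\<close> has the form \<open>1 - q(z)(1 - z)\<close>. The minimiser of the
  norm of \<open>D\<^sub>1\<close> among those of degree below \<open>n\<close> has coefficients proportional to \<open>1/(k+1)\<close>, and its
  squared norm is the reciprocal of the \<open>n\<close>-th harmonic number.\<close>

lemma cyclic_one_minus_z:
  assumes "\<alpha> \<le> 1"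
  shows "cyclic_fun \<alpha> (poly [:1, -1:])"
  unfolding cyclic_fun_poly_iff
proof (intro allI impI)
  fix \<epsilon> :: real assume "\<epsilon> > 0"
  \<comment> \<open>The harmonic series diverges, so the final bound 1/H can be pushed below
    \<epsilon>.\<close>
  have "eventually (\<lambda>n. harm n > 1 / \<epsilon>) sequentially"
    using harm_at_top by (simp add: filterlim_at_top_dense)
  then obtain n where n: "harm n > 1 / \<epsilon>" by (auto dest: eventually_happens)
  define H where "H = (harm n :: real)"
  have "1 / \<epsilon> > 0" using \<open>\<epsilon> > 0\<close> by simp
  then have "H > 0" using n unfolding H_def by linarith
  \<comment> \<open>Dividing by H makes the coefficients sum to 1, that is r(1) = 1.\<close>
  define r :: "complex poly" where "r = (\<Sum>k<n. monom (of_real (1 / (H * real (Suc k)))) k)"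
  have cr: "coeff r k = (if k < n then of_real (1 / (H * real (Suc k))) else 0)" for k
    by (simp add: r_def coeff_sum)
  have "cmod (of_real (1 / (H * real (Suc k)))) = 1 / (H * real (Suc k))" for k
    unfolding norm_of_real using \<open>H > 0\<close> by (intro abs_of_pos) simp
  then have norm_cr: "cmod (coeff r k) = (if k < n then 1 / (H * real (Suc k)) else 0)" for k
    by (simp only: cr if_distrib[of cmod] norm_zero)
  have "(\<Sum>k<n. 1 / (H * real (Suc k))) = harm n / H"
    unfolding harm_altdef sum_divide_distrib by (intro sum.cong refl) (simp add: field_simps)
  then have H1: "(\<Sum>k<n. 1 / (H * real (Suc k))) = 1"
    using \<open>H > 0\<close> unfolding H_def[symmetric] by simp
  then have "poly r 1 = 1"
    unfolding r_def poly_sum poly_monom power_one mult_1_right of_real_sum[symmetric] by simp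
  then have "[:-1, 1:] dvd 1 - r" using poly_eq_0_iff_dvd[of "1 - r" 1] by simp
  then obtain q where q: "1 - r = [:-1, 1:] * q" by (rule dvdE)
  \<comment> \<open>The root factor is z - 1 rather than 1 - z, so the multiplier is
    \<open>- q\<close>.\<close>
  have "(- q) * [:1, -1:] = [:-1, 1:] * q" by simp
  also have "\<dots> = 1 - r" by (rule q[symmetric])
  finally have r: "1 - (- q) * [:1, -1:] = r" by (simp only: diff_diff_eq2 add_diff_cancel_left')
  have "sq_norm \<alpha> (fps_of_poly r) = (\<Sum>k<n. (1 / (H * real (Suc k)))\<^sup>2 * (real k + 1) powr \<alpha>)"
    unfolding sq_norm_def fps_of_poly_nth
    by (subst suminf_finite[of "{..<n}"]) (simp_all add: norm_cr)
  \<comment> \<open>Here \<alpha> \<le> 1 enters: the bases k+1 are at least 1, so the weights of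
    exponent 1 dominate. One factor k+1 then cancels.\<close>
  also have "\<dots> \<le> (\<Sum>k<n. (1 / (H * real (Suc k)))\<^sup>2 * (real k + 1) powr 1)"
    using assms by (intro sum_mono mult_left_mono powr_mono) auto
  also have "\<dots> = (\<Sum>k<n. 1 / (H * real (Suc k)) / H)"
  proof (intro sum.cong refl)
    have "(1 / (H * m))\<^sup>2 * m powr 1 = 1 / (H * m) / H" if "m > 0" for m
      using that \<open>H > 0\<close> by (simp add: power2_eq_square)
    then show "(1 / (H * real (Suc k)))\<^sup>2 * (real k + 1) powr 1 = 1 / (H * real (Suc k)) / H" for k
      using of_nat_Suc[of k, where 'a = real] by (metis add.commute of_nat_0_less_iff zero_less_Suc)
  qed
  also have "\<dots> = 1 / H" unfolding sum_divide_distrib[symmetric] H1 ..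
  also have "\<dots> < \<epsilon>" using n \<open>\<epsilon> > 0\<close> \<open>H > 0\<close> by (simp add: H_def field_simps)
  finally show "\<exists>q. sq_norm \<alpha> (fps_of_poly (1 - q * [:1, -1:])) < \<epsilon>"
    by (intro exI[of _ "- q"]) (simp only: r)
qed

text \<open>Each \<open>F n\<close> vanishes at the reciprocal of 1 + 1/(n+1), a nonzero point of
  the disc, and differs from 1 - z by the multiple -z/(n+1) of z.\<close>

lemma noncyclic_sequence_to_one_minus_z:
  defines "F \<equiv> \<lambda>n. poly [:1, - of_real (1 + 1 / real (Suc n)):]"
  shows "noncyclic_fun \<alpha> (F n)" "dirichlet_converges \<alpha> F (poly [:1, -1:])"
proof -
  have not_cyclic: "\<not> cyclic_fun \<alpha> (poly [:1, - of_real r:])" if "r > 1" for r :: real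
  proof (rule not_cyclic_poly_zero_in_disc)
    show "poly [:1, - of_real r:] (of_real (1 / r)) = (0 :: complex)" using that by simp
    show "of_real (1 / r) \<noteq> (0 :: complex)" using that by simp
    show "cmod (of_real (1 / r)) < 1" using that unfolding norm_of_real by simp
  qed
  have "\<not> cyclic_fun \<alpha> (F n)" unfolding F_def by (rule not_cyclic) simp
  then show "noncyclic_fun \<alpha> (F n)"
    by (simp add: noncyclic_fun_def F_def poly_in_dirichlet_space)
  have norm_eq: "dirichlet_norm \<alpha> (F n - poly [:1, -1:]) =
      1 / real (Suc n) * sqrt (sq_norm \<alpha> fps_X)" for n
  proof -
    let ?c = "- of_real (1 / real (Suc n)) :: complex"
    have "F n - poly [:1, -1:] = poly [:0, ?c:]"
      by (simp add: F_def fun_eq_iff algebra_simps)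
    moreover have "fps_of_poly [:0, ?c:] = fps_const ?c * fps_X"
      by (simp add: fps_of_poly_pCons)
    moreover have "sq_norm \<alpha> (fps_const ?c * fps_X) = (cmod ?c)\<^sup>2 * sq_norm \<alpha> fps_X"
      using sq_norm_const_mult(2)[OF fps_of_poly_in_dirichlet[of "[:0, 1:]"]] by simp
    ultimately have "dirichlet_norm \<alpha> (F n - poly [:1, -1:]) = sqrt ((cmod ?c)\<^sup>2 * sq_norm \<alpha> fps_X)"
      by (simp only: dirichlet_norm_eq fps_expansion_eqI[OF has_fps_expansion_poly])
    then show ?thesis
      unfolding norm_minus_cancel norm_of_real real_sqrt_mult real_sqrt_abs by simp
  qed
  have "(\<lambda>n. 1 / real (Suc n) * sqrt (sq_norm \<alpha> fps_X)) \<longlonglongrightarrow> 0"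
    by (rule tendsto_mult_left_zero) (rule LIMSEQ_Suc[OF lim_1_over_n])
  then show "dirichlet_converges \<alpha> F (poly [:1, -1:])"
    unfolding dirichlet_converges_def norm_eq by (simp add: F_def poly_in_dirichlet_space)
qed

theorem proposition3p3:
  fixes \<alpha> :: real
  shows "(\<alpha> > 1 \<longrightarrow>
            (\<forall>F g. (\<forall>n. noncyclic_fun \<alpha> (F n)) \<and> dirichlet_converges \<alpha> F g
                   \<longrightarrow> \<not> cyclic_fun \<alpha> g)) \<and>
         (\<alpha> \<le> 1 \<longrightarrow>
            (\<exists>F g. (\<forall>n. noncyclic_fun \<alpha> (F n)) \<and> dirichlet_converges \<alpha> F g
                   \<and> cyclic_fun \<alpha> g))"
proof (intro conjI impI allI notI)
  \<comment> \<open>By openness, a cyclic limit would force some \<open>F n\<close> to be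
    cyclic.\<close>
  fix F g
  assume "\<alpha> > 1" "(\<forall>n. noncyclic_fun \<alpha> (F n)) \<and> dirichlet_converges \<alpha> F g" "cyclic_fun \<alpha> g"
  then show False using cyclic_fun_open by (auto simp: noncyclic_fun_def)
next
  assume "\<alpha> \<le> 1"
  then show "\<exists>F g. (\<forall>n. noncyclic_fun \<alpha> (F n)) \<and> dirichlet_converges \<alpha> F g \<and> cyclic_fun \<alpha> g"
    using noncyclic_sequence_to_one_minus_z cyclic_one_minus_z
    by (intro exI[of _ "poly [:1, -1:]"] exI[of _ "\<lambda>n. poly [:1, - of_real (1 + 1 / real (Suc n)):]"]
        conjI allI)
qed

end
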